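(* Let $G$ be a graph of order $n \geq 2$ that has a dominating vertex (a vertex adjacent to every other vertex of $G$). Then $\gamma_s(\mu(G)) = 3$.
   Context: All graphs are finite, simple, undirected, with nonempty vertex set; the order of a graph is its number of vertices. A set $S\subseteq V(G)$ is a dominating set of $G$ if every vertex of $V(G)\setminus S$ is adjacent to some vertex of $S$. A dominating set $S$ is a secure dominating set of $G$ if for every $u\in V(G)\setminus S$ there is $v\in S$ adjacent to $u$ such that $(S\setminus\{v\})\cup\{u\}$ is a dominating set of $G$. The secure domination number $\gamma_s(G)$ is the minimum cardinality of a secure dominating set of $G$. For a graph $G$ with vertices $v_1,\dots,v_n$, the Mycielskian $\mu(G)$ is the graph with vertex set $\{v_1,\dots,v_n,u_1,\dots,u_n,w\}$ ($2n+1$ distinct vertices) whose edges are: all edges of $G$; the edges $wu_i$ for $1\le i\le n$; and, for each edge $v_iv_j$ of $G$, the edges $u_iv_j$ and $v_iu_j$. *)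

theory Defs
  imports "Graph_Theory.Pair_Digraph"
begin

text \<open>
  A finite simple undirected graph is a \<open>pair_graph\<close>: a finite, loop-free, symmetric relation
  \<open>parcs G\<close> on the finite vertex set \<open>pverts G\<close>.  An undirected edge \<open>uv\<close> is present in
  \<open>parcs G\<close> as the two arcs \<open>(u, v)\<close> and \<open>(v, u)\<close>.  The locale admits the empty vertex set.
\<close>

definition dominating_vertex :: "'a pair_pre_digraph \<Rightarrow> 'a \<Rightarrow> bool" where
  "dominating_vertex G x \<longleftrightarrow> x \<in> pverts G \<and> (\<forall>y \<in> pverts G - {x}. (x, y) \<in> parcs G)"

definition dominating_set :: "'a pair_pre_digraph \<Rightarrow> 'a set \<Rightarrow> bool" where
  "dominating_set G S \<longleftrightarrow>
     S \<subseteq> pverts G \<and> (\<forall>u \<in> pverts G - S. \<exists>v \<in> S. (u, v) \<in> parcs G)"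

definition secure_dominating_set :: "'a pair_pre_digraph \<Rightarrow> 'a set \<Rightarrow> bool" where
  "secure_dominating_set G S \<longleftrightarrow>
     dominating_set G S \<and>
     (\<forall>u \<in> pverts G - S. \<exists>v \<in> S. (u, v) \<in> parcs G \<and> dominating_set G ((S - {v}) \<union> {u}))"

definition secure_domination_number :: "'a pair_pre_digraph \<Rightarrow> nat" where
  "secure_domination_number G = Min (card ` {S. secure_dominating_set G S})"

text \<open>
  On a finite graph the minimum ranges over a finite nonempty set.
\<close>

lemma secure_dominating_set_pverts: "secure_dominating_set G (pverts G)"
  by (simp add: secure_dominating_set_def dominating_set_def)

lemma finite_secure_dominating_sets:
  "finite (pverts G) \<Longrightarrow> finite {S. secure_dominating_set G S}"
  by (rule finite_subset[of _ "Pow (pverts G)"])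
    (auto simp: secure_dominating_set_def dominating_set_def)

text \<open>
  Vertices of the Mycielskian: \<open>Orig v\<^sub>i\<close> is \<open>v\<^sub>i\<close>, \<open>Copy v\<^sub>i\<close> is \<open>u\<^sub>i\<close>, and \<open>Apex\<close> is \<open>w\<close>.
\<close>

datatype 'a mycielski_vertex = Orig 'a | Copy 'a | Apex

text \<open>
  The arcs are listed as the edges of \<open>G\<close>, the edges \<open>w u\<^sub>i\<close>, and the edges between copies and
  originals; each edge contributes both orientations because \<open>parcs G\<close> is symmetric.
\<close>

definition mycielskian :: "'a pair_pre_digraph \<Rightarrow> 'a mycielski_vertex pair_pre_digraph" where
  "mycielskian G =
     \<lparr> pverts = Orig ` pverts G \<union> Copy ` pverts G \<union> {Apex},
       parcs =
         {(Orig x, Orig y) | x y. (x, y) \<in> parcs G}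
         \<union> ({(Apex, Copy x) | x. x \<in> pverts G} \<union> {(Copy x, Apex) | x. x \<in> pverts G})
         \<union> ({(Copy x, Orig y) | x y. (x, y) \<in> parcs G}
            \<union> {(Orig x, Copy y) | x y. (x, y) \<in> parcs G}) \<rparr>"

lemma pair_graph_mycielskian:
  assumes "pair_graph G"
  shows "pair_graph (mycielskian G)"
proof -
  interpret pair_graph G by (rule assms)
  let ?V = "pverts (mycielskian G)" and ?E = "parcs (mycielskian G)"
  have wf: "?E \<subseteq> ?V \<times> ?V"
    by (auto simp: mycielskian_def dest: in_arcsD1 in_arcsD2)
  have fin: "finite ?V"
    by (simp add: mycielskian_def pair_finite_verts)
  have finE: "finite ?E"
    by (rule finite_subset[OF wf]) (simp add: fin)
  have sym: "sym ?E"
    by (auto simp: mycielskian_def sym_def dest: arcs_symmetric)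
  have loopfree: "fst e \<noteq> snd e" if "e \<in> ?E" for e
    using that by (auto simp: mycielskian_def dest: no_loops')
  show ?thesis
    by unfold_locales (use wf fin finE sym loopfree in \<open>auto simp: symmetric_def\<close>)
qed

end

theory Submission
  imports Defs
begin

text \<open>
  Three guards suffice: they sit on \<open>Apex\<close>, which covers all copies, and on the two twins
  \<open>Orig d\<close> and \<open>Copy d\<close> of a dominating vertex \<open>d\<close>.  Each twin covers every original
  except possibly \<open>Orig d\<close>.  An attack on an original is answered by \<open>Copy d\<close>, which leaves
  \<open>Orig d\<close> to cover the originals; an attack on \<open>Copy y\<close> is answered by \<open>Orig d\<close>, whose
  place is then itself covered by \<open>Copy y\<close> (lemma \<open>secure_dominating_triple\<close>).

  Two guards never suffice, whatever the graph, as soon as it has two vertices.  Since \<open>Orig x\<close>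
  and \<open>Copy x\<close> are not adjacent, and neither are two copies nor \<open>Apex\<close> and an original, a
  dominating pair (possibly a repeated vertex) can only have the form
  \<open>{Apex, Orig x}\<close>, \<open>{Copy x, Orig x}\<close> or \<open>{Copy x, Copy z}\<close> (lemma
  \<open>dominating_pair_cases\<close>).  The respective attacks on \<open>Copy y\<close> and on \<open>Orig y\<close>, where
  \<open>y\<close> differs from \<open>x\<close>, and on \<open>Apex\<close>
  lead out of this list, however the attack is answered.
\<close>

lemma pverts_mycielskian_iff [simp]:
  "Orig x \<in> pverts (mycielskian G) \<longleftrightarrow> x \<in> pverts G"
  "Copy x \<in> pverts (mycielskian G) \<longleftrightarrow> x \<in> pverts G"
  "Apex \<in> pverts (mycielskian G)"
  by (auto simp: mycielskian_def)

lemma parcs_mycielskian_iff [simp]: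
  "(Orig x, Orig y) \<in> parcs (mycielskian G) \<longleftrightarrow> (x, y) \<in> parcs G"
  "(Orig x, Copy y) \<in> parcs (mycielskian G) \<longleftrightarrow> (x, y) \<in> parcs G"
  "(Copy x, Orig y) \<in> parcs (mycielskian G) \<longleftrightarrow> (x, y) \<in> parcs G"
  "(Copy x, Copy y) \<notin> parcs (mycielskian G)"
  "(Apex, Copy y) \<in> parcs (mycielskian G) \<longleftrightarrow> y \<in> pverts G"
  "(Copy y, Apex) \<in> parcs (mycielskian G) \<longleftrightarrow> y \<in> pverts G"
  "(Apex, Orig y) \<notin> parcs (mycielskian G)"
  "(Orig y, Apex) \<notin> parcs (mycielskian G)"
  "(Apex, Apex) \<notin> parcs (mycielskian G)"
  by (auto simp: mycielskian_def)

lemma dominating_set_mycielskian_iff: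
  "dominating_set (mycielskian G) S \<longleftrightarrow>
     S \<subseteq> pverts (mycielskian G) \<and>
     (\<forall>x \<in> pverts G. Orig x \<notin> S \<longrightarrow> (\<exists>v \<in> S. (Orig x, v) \<in> parcs (mycielskian G))) \<and>
     (\<forall>x \<in> pverts G. Copy x \<notin> S \<longrightarrow> (\<exists>v \<in> S. (Copy x, v) \<in> parcs (mycielskian G))) \<and>
     (Apex \<notin> S \<longrightarrow> (\<exists>v \<in> S. (Apex, v) \<in> parcs (mycielskian G)))"
proof -
  have V: "pverts (mycielskian G) = Orig ` pverts G \<union> Copy ` pverts G \<union> {Apex}"
    by (simp add: mycielskian_def)
  have "(\<forall>u \<in> pverts (mycielskian G) - S. P u) \<longleftrightarrow>
      (\<forall>x \<in> pverts G. Orig x \<notin> S \<longrightarrow> P (Orig x)) \<and>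
      (\<forall>x \<in> pverts G. Copy x \<notin> S \<longrightarrow> P (Copy x)) \<and> (Apex \<notin> S \<longrightarrow> P Apex)" for P
    unfolding V by blast
  then show ?thesis by (simp only: dominating_set_def)
qed

section \<open>Three guards suffice\<close>

lemma secure_dominating_triple:
  assumes "pair_graph G" and d: "dominating_vertex G d"
  shows "secure_dominating_set (mycielskian G) {Orig d, Copy d, Apex}"
proof -
  interpret pair_graph G by fact
  let ?M = "mycielskian G" and ?S = "{Orig d, Copy d, Apex}"
  have dV: "d \<in> pverts G" using d by (simp add: dominating_vertex_def)
  have to: "(y, d) \<in> parcs G" and from_d: "(d, y) \<in> parcs G" if "y \<in> pverts G" "y \<noteq> d" for y
    using d that by (auto simp: dominating_vertex_def intro: arcs_symmetric)
  have dom: "dominating_set ?M ?S"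
    using dV to by (auto simp: dominating_set_mycielskian_iff)
  have "\<exists>v \<in> ?S. (u, v) \<in> parcs ?M \<and> dominating_set ?M ((?S - {v}) \<union> {u})"
    if u: "u \<in> pverts ?M - ?S" for u
  proof (cases u)
    case (Orig y)
    with u have y: "y \<in> pverts G" "y \<noteq> d" by auto
    have "dominating_set ?M {Orig d, Apex, Orig y}"
      using dV y to by (auto simp: dominating_set_mycielskian_iff)
    moreover have "(?S - {Copy d}) \<union> {u} = {Orig d, Apex, Orig y}"
      using Orig by auto
    ultimately show ?thesis
      using Orig to[OF y] by (intro bexI[of _ "Copy d"]) simp_all
  next
    case (Copy y)
    with u have y: "y \<in> pverts G" "y \<noteq> d" by auto
    have "dominating_set ?M {Copy d, Apex, Copy y}"
      using dV y to from_d[OF y] by (auto simp: dominating_set_mycielskian_iff)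
    moreover have "(?S - {Orig d}) \<union> {u} = {Copy d, Apex, Copy y}"
      using Copy by auto
    ultimately show ?thesis
      using Copy to[OF y] by (intro bexI[of _ "Orig d"]) simp_all
  next
    case Apex
    with u show ?thesis by simp
  qed
  with dom show ?thesis by (simp add: secure_dominating_set_def)
qed

section \<open>Two guards do not suffice\<close>

text \<open>
  \<open>Apex\<close> needs itself or a copy among the guards, which rules out two originals.
  \<open>Copy x\<close> covers neither its twin \<open>Orig x\<close> nor another copy: this rules out
  \<open>{Apex, Copy x}\<close>, and \<open>{Copy x, Orig y}\<close> unless \<open>x = y\<close>, since \<open>Copy y\<close> would stay
  uncovered.  The vertices \<open>a\<close> and \<open>b\<close> may coincide, so that singletons are covered too.
\<close>

lemma dominating_pair_cases:
  assumes "pair_graph G" and ne: "pverts G \<noteq> {}"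
    and dom: "dominating_set (mycielskian G) {a, b}"
  obtains (apex_orig) x where "{a, b} = {Apex, Orig x}"
  | (twins) x where "{a, b} = {Copy x, Orig x}"
  | (copies) x y where "{a, b} = {Copy x, Copy y}"
proof -
  interpret pair_graph G by fact
  have irrefl: "(x, x) \<notin> parcs G" for x by (auto dest: no_loops')
  let ?D = "dominating_set (mycielskian G)"
  have no_apex: "\<not> ?D {Apex, Apex}"
    using ne by (auto simp: dominating_set_mycielskian_iff)
  have no_origs: "\<not> ?D {Orig x, Orig y}" for x y
    by (auto simp: dominating_set_mycielskian_iff)
  have no_apex_copy: "\<not> ?D {Apex, Copy x}" for x
    using irrefl by (auto simp: dominating_set_mycielskian_iff)
  have twins_eq: "x = y" if "?D {Copy x, Orig y}" for x y
    using that irrefl by (auto simp: dominating_set_mycielskian_iff)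
  show ?thesis
  proof (cases a)
    case a: (Orig x)
    show ?thesis
    proof (cases b)
      case (Orig y) then show ?thesis using dom a no_origs by simp
    next
      case (Copy y) then show ?thesis using dom a twins_eq twins by (metis insert_commute)
    next
      case Apex then show ?thesis using a apex_orig by (metis insert_commute)
    qed
  next
    case a: (Copy x)
    show ?thesis
    proof (cases b)
      case (Orig y) then show ?thesis using dom a twins_eq twins by metis
    next
      case (Copy y) then show ?thesis using a copies by metis
    next
      case Apex then show ?thesis using dom a no_apex_copy by (metis insert_commute)
    qed
  next
    case a: Apex
    show ?thesis
    proof (cases b)
      case (Orig y) then show ?thesis using a apex_orig by metis
    next
      case (Copy y) then show ?thesis using dom a no_apex_copy by metis
    next
      case Apex then show ?thesis using dom a no_apex by simp
    qed
  qed
qed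

text \<open>
  The attacked vertex replaces one guard, so it and the other guard form a dominating pair.  If
  \<open>a = b\<close>, the attacked vertex dominates alone, and adding the old guard keeps it dominating.
\<close>

lemma secure_pair_response:
  assumes sec: "secure_dominating_set H {a, b}" and u: "u \<in> pverts H" "u \<notin> {a, b}"
  shows "dominating_set H {u, a} \<or> dominating_set H {u, b}"
proof -
  have ab: "a \<in> pverts H" "b \<in> pverts H"
    using sec by (auto simp: secure_dominating_set_def dominating_set_def)
  obtain v where v: "v \<in> {a, b}" and dom: "dominating_set H (({a, b} - {v}) \<union> {u})"
    using sec u unfolding secure_dominating_set_def by blast
  have mono: "dominating_set H T"
    if "({a, b} - {v}) \<union> {u} \<subseteq> T" "T \<subseteq> pverts H" for T
    using dom that unfolding dominating_set_def by blast
  have "({a, b} - {v}) \<union> {u} \<subseteq> {u, a} \<or> ({a, b} - {v}) \<union> {u} \<subseteq> {u, b}"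
    using v by auto
  then show ?thesis using mono u ab by auto
qed

lemma not_secure_dominating_pair:
  assumes G: "pair_graph G" and two: "card (pverts G) \<ge> 2"
  shows "\<not> secure_dominating_set (mycielskian G) {a, b}"
proof
  assume sec: "secure_dominating_set (mycielskian G) {a, b}"
  then have dom: "dominating_set (mycielskian G) {a, b}"
    by (simp add: secure_dominating_set_def)
  have ne: "pverts G \<noteq> {}" using two by auto
  have other: "\<exists>y \<in> pverts G. y \<noteq> x" for x
  proof (rule ccontr)
    assume "\<not> ?thesis"
    then have "pverts G \<subseteq> {x}" by blast
    then have "card (pverts G) \<le> 1" using card_mono[of "{x}" "pverts G"] by simp
    with two show False by simp
  qed
  note pair_cases =
    dominating_pair_cases[OF G ne, consumes 1, case_names apex_orig twins copies]
  from dom show False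
  proof (cases rule: pair_cases)
    case (apex_orig x)
    obtain y where y: "y \<in> pverts G" "y \<noteq> x" using other by blast
    have "dominating_set (mycielskian G) {Copy y, Apex} \<or>
          dominating_set (mycielskian G) {Copy y, Orig x}"
      using secure_pair_response[OF sec[unfolded apex_orig], of "Copy y"] y by simp
    then show False using y by (elim disjE pair_cases) (auto simp: doubleton_eq_iff)
  next
    case (twins x)
    obtain y where y: "y \<in> pverts G" "y \<noteq> x" using other by blast
    have "dominating_set (mycielskian G) {Orig y, Copy x} \<or>
          dominating_set (mycielskian G) {Orig y, Orig x}"
      using secure_pair_response[OF sec[unfolded twins], of "Orig y"] y by simp
    then show False using y by (elim disjE pair_cases) (auto simp: doubleton_eq_iff)
  next
    case (copies x y)
    have "dominating_set (mycielskian G) {Apex, Copy x} \<or>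
          dominating_set (mycielskian G) {Apex, Copy y}"
      using secure_pair_response[OF sec[unfolded copies], of "Apex"] by simp
    then show False by (elim disjE pair_cases) (auto simp: doubleton_eq_iff)
  qed
qed

lemma secure_dominating_set_card_ge_3:
  assumes G: "pair_graph G" and two: "card (pverts G) \<ge> 2"
    and sec: "secure_dominating_set (mycielskian G) S"
  shows "3 \<le> card S"
proof (rule ccontr)
  assume "\<not> 3 \<le> card S"
  have sub: "S \<subseteq> pverts (mycielskian G)" and "S \<noteq> {}"
    using sec by (auto simp: secure_dominating_set_def dominating_set_mycielskian_iff)
  interpret M: pair_graph "mycielskian G" by (rule pair_graph_mycielskian[OF G])
  have "finite S" using sub M.pair_finite_verts by (rule finite_subset)
  with \<open>S \<noteq> {}\<close> have "card S \<noteq> 0" by simp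
  with \<open>\<not> 3 \<le> card S\<close> have "card S = 1 \<or> card S = 2" by linarith
  then obtain a b where "S = {a, b}"
    by (metis card_1_singletonE card_2_iff insert_absorb2)
  with sec not_secure_dominating_pair[OF G two] show False by blast
qed

section \<open>The secure domination number\<close>

theorem theorem2p1:
  fixes G :: "'a pair_pre_digraph"
  assumes "pair_graph G"
    and "card (pverts G) \<ge> 2"
    and "\<exists>x. dominating_vertex G x"
  shows "secure_domination_number (mycielskian G) = 3"
proof -
  interpret M: pair_graph "mycielskian G" by (rule pair_graph_mycielskian[OF assms(1)])
  obtain d where "dominating_vertex G d" using assms(3) by blast
  then have "secure_dominating_set (mycielskian G) {Orig d, Copy d, Apex}"
    by (rule secure_dominating_triple[OF assms(1)])
  moreover have "card {Orig d, Copy d, Apex} = 3" by simp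
  ultimately have "3 \<in> card ` {S. secure_dominating_set (mycielskian G) S}"
    by (metis image_eqI mem_Collect_eq)
  then show ?thesis
    unfolding secure_domination_number_def
    using finite_secure_dominating_sets[OF M.pair_finite_verts]
      secure_dominating_set_card_ge_3[OF assms(1,2)]
    by (intro Min_eqI) auto
qed

end
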